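(* Let $\hat\gamma_{(i)}=G_{(i)}\hat\gamma_{MRE}$ and $\hat\gamma_{(j)}=G_{(j)}\hat\gamma_{MRE}$ be two generalized stochastic restricted estimators of $\gamma$ in the regression model misspecified by excluding relevant variables, with predictors $\hat y_{(i)}=X_*\hat\gamma_{(i)}$ and $\hat y_{(j)}=X_*\hat\gamma_{(j)}$. Put $b_{(i)}=Bias(\hat\gamma_{(i)})$, $b_{(j)}=Bias(\hat\gamma_{(j)})$, $\Delta_{(i,j)}=MSEM(\hat\gamma_{(i)})-MSEM(\hat\gamma_{(j)})$, $$A=X_*\Delta_{(i,j)}X_*'+X_*(b_{(i)}-b_{(j)})(b_{(i)}-b_{(j)})'X_*'+\delta\delta',\qquad \theta=\delta+X_*(b_{(i)}-b_{(j)}).$$ If $A\ge 0$, then $\hat y_{(j)}$ is superior to $\hat y_{(i)}$ in the MSEM sense (that is, $MSEM(\hat y_{(i)})-MSEM(\hat y_{(j)})\ge0$) if and only if $\theta\in\mathfrak{R}(A)$ and $\theta'A^{-}\theta\le 1$, where $\mathfrak{R}(A)$ is the column space of $A$ and $A^{-}$ is any generalized inverse of $A$ (the choice being immaterial).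
   Context: The true regression model is $y=X_1\beta_1+X_2\beta_2+\varepsilon=X_1\beta_1+\delta+\varepsilon$ with $\delta=X_2\beta_2$, where $y$ is an $n\times 1$ random vector, $X_1$ ($n\times l$) and $X_2$ ($n\times p$) are non-random matrices, $\beta_1$ ($l\times1$) and $\beta_2$ ($p\times 1$) are unknown fixed vectors, $E(\varepsilon)=0$ and $E(\varepsilon\varepsilon')=\sigma^2 I$, $\sigma^2>0$. The researcher misspecifies the model, excluding $X_2$, as $y=X_1\beta_1+u$ (so $u=\delta+\varepsilon$). Prior information is given as $r=R\beta_1+g+v$, where $r$ is $q\times1$, $R$ is a given $q\times l$ matrix of rank $q$, $g$ is a fixed unknown $q\times 1$ vector, $E(v)=0$, $E(vv')=\Psi=\sigma^2W$ with $W$ positive definite, and $E(vu')=0$. The matrix $X_1'X_1$ is positive definite. Let $B$ be a nonsingular $l\times l$ matrix with $B'X_1'X_1B=I$ and $B'R'\Psi^{-1}RB=\Lambda$, $\Lambda$ diagonal with diagonal entries $\lambda_1,\dots,\lambda_q>0$ and $\lambda_{q+1}=\dots=\lambda_l=0$. Put $X_*=X_1B$, $R_*=RB$, $\gamma=B^{-1}\beta_1$, so $y=X_*\gamma+\delta+\varepsilon$ and $r=R_*\gamma+g+v$. The mixed regression estimator is $\hat\gamma_{MRE}=(I+\sigma^2\Lambda)^{-1}(X_*'y+R_*'W^{-1}r)$. A generalized stochastic restricted estimator is $\hat\gamma_{(j)}=G_{(j)}\hat\gamma_{MRE}$ with $G_{(j)}$ a non-random non-negative definite (possibly positive definite) $l\times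 l$ matrix; it represents the estimators with $G_{(j)}$ equal to $I$, $(1+k)^{-1}I$, $(1+k)^{-2}(1+2k)I$, $2^{-1}(1+d)I$, $2^{-2}(1+d)(3-d)I$, $T_hT_h'$, $(1+k)^{-1}T_hT_h'$, $2^{-1}(1+d)T_hT_h'$, where $k>0$, $0<d<1$ and $T_h$ consists of the first $h$ columns of an orthogonal matrix of eigenvectors of $X_1'X_1$. For an estimator $\hat\gamma$ of $\gamma$: $Bias(\hat\gamma)=E(\hat\gamma)-\gamma$, $MSEM(\hat\gamma)=E(\hat\gamma-\gamma)(\hat\gamma-\gamma)'$. For a predictor $\hat y=X_*\hat\gamma$ of the actual value $y_0=X_*\gamma+\delta$: $MSEM(\hat y)=E(\hat y-y_0)(\hat y-y_0)'$. For symmetric matrices, $M\ge0$ means $M$ is non-negative definite. *)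

theory Defs
  imports "HOL-Probability.Probability"
begin

definition nonneg_definite :: "real^'n^'n \<Rightarrow> bool" where
  "nonneg_definite A \<longleftrightarrow> transpose A = A \<and> (\<forall>x. 0 \<le> x \<bullet> (A *v x))"

definition pos_definite :: "real^'n^'n \<Rightarrow> bool" where
  "pos_definite A \<longleftrightarrow> transpose A = A \<and> (\<forall>x. x \<noteq> 0 \<longrightarrow> 0 < x \<bullet> (A *v x))"

text \<open>The matrix \<open>x y'\<close> of column vectors \<open>x\<close>, \<open>y\<close>.\<close>

definition outer :: "real^'m \<Rightarrow> real^'n \<Rightarrow> real^'n^'m" where
  "outer x y = (\<chi> i j. x $ i * y $ j)"

definition generalized_inverse :: "real^'n^'m \<Rightarrow> real^'m^'n \<Rightarrow> bool" where
  "generalized_inverse A X \<longleftrightarrow> A ** X ** A = A"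

definition bias :: "'w measure \<Rightarrow> ('w \<Rightarrow> real^'n) \<Rightarrow> real^'n \<Rightarrow> real^'n" where
  "bias M est target = (\<integral>\<omega>. est \<omega> \<partial>M) - target"

definition msem :: "'w measure \<Rightarrow> ('w \<Rightarrow> real^'n) \<Rightarrow> real^'n \<Rightarrow> real^'n^'n" where
  "msem M est target = (\<integral>\<omega>. outer (est \<omega> - target) (est \<omega> - target) \<partial>M)"

text \<open>A random vector with finite second moments; on a probability space it is then
  integrable, and the outer product of two such vectors is integrable as well.\<close>

definition square_integrable :: "'w measure \<Rightarrow> ('w \<Rightarrow> real^'n) \<Rightarrow> bool" where
  "square_integrable M f \<longleftrightarrow> f \<in> borel_measurable M \<and> integrable M (\<lambda>\<omega>. (norm (f \<omega>))\<^sup>2)"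

text \<open>\<open>(I + \<sigma>\<^sup>2 \<Lambda>)\<^sup>-\<^sup>1 (X' y + R' W\<^sup>-\<^sup>1 r)\<close> for an error variance \<open>s = \<sigma>\<^sup>2\<close>.\<close>

definition mixed_estimator ::
    "real \<Rightarrow> real^'l^'l \<Rightarrow> real^'l^'n \<Rightarrow> real^'l^'q \<Rightarrow> real^'q^'q \<Rightarrow> real^'n \<Rightarrow> real^'q \<Rightarrow> real^'l" where
  "mixed_estimator s \<Lambda> X R W y r =
     matrix_inv (mat 1 + s *\<^sub>R \<Lambda>) *v (transpose X *v y + transpose R *v (matrix_inv W *v r))"

lemma generalized_inverse_exists:
  fixes A :: "real^'n^'m"
  shows "\<exists>X. generalized_inverse A X"
proof -
  obtain C where C: "C \<subseteq> range ((*v) A)" "independent C" "range ((*v) A) \<subseteq> span C"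
    by (rule basis_exists)
  define h where "h b = (SOME x. A *v x = b)" for b
  have h: "A *v h b = b" if "b \<in> C" for b
  proof -
    have "\<exists>x. A *v x = b" using that C(1) by (metis imageE subsetD)
    then show ?thesis unfolding h_def by (rule someI_ex)
  qed
  obtain g where g: "linear g" "\<forall>b\<in>C. g b = h b"
    using linear_independent_extend[OF C(2), of h] by blast
  have lin: "linear (\<lambda>y. A *v g y)"
    using linear_compose[OF g(1) matrix_vector_mul_linear[of A]] by (simp add: o_def)
  have id: "A *v g y = y" if "y \<in> span C" for y
    using linear_eq_on_span[OF lin linear_id, of C y] that g(2) h by auto
  have "A ** matrix g ** A *v x = A *v x" for x
  proof -
    have "A *v x \<in> span C" using C(3) by auto
    moreover have "matrix g *v z = g z" for z
      using fun_cong[OF matrix_vector_mul(2)[OF g(1)], of z] by simp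
    ultimately show ?thesis
      using id by (simp flip: matrix_vector_mul_assoc)
  qed
  then have "A ** matrix g ** A = A" by (simp add: matrix_eq)
  then show ?thesis unfolding generalized_inverse_def by blast
qed

lemma generalized_inverse_quadratic_form_unique:
  fixes A :: "real^'n^'n"
  assumes "transpose A = A" "\<theta> \<in> span (columns A)"
    and "generalized_inverse A X" "generalized_inverse A Y"
  shows "\<theta> \<bullet> (X *v \<theta>) = \<theta> \<bullet> (Y *v \<theta>)"
proof -
  have "span (columns A) \<subseteq> range ((*v) A)"
  proof (rule span_minimal)
    show "columns A \<subseteq> range ((*v) A)" by (auto simp: columns_image_basis)
    show "subspace (range ((*v) A))"
      by (intro linear_subspace_image matrix_vector_mul_linear subspace_UNIV)
  qed
  then obtain z where z: "\<theta> = A *v z" using assms(2) by blast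
  have "\<theta> \<bullet> (Z *v \<theta>) = z \<bullet> (A *v z)" if "A ** Z ** A = A" for Z
  proof -
    have "\<theta> \<bullet> (Z *v \<theta>) = z \<bullet> (A *v (Z *v (A *v z)))"
      unfolding z using assms(1) dot_lmul_matrix[of z A] by (metis transpose_matrix_vector)
    also have "\<dots> = z \<bullet> ((A ** Z ** A) *v z)"
      by (simp add: matrix_vector_mul_assoc matrix_mul_assoc)
    finally show ?thesis using that by simp
  qed
  then show ?thesis using assms(3,4) by (simp add: generalized_inverse_def)
qed

end

theory Submission
  imports Defs
begin

text \<open>Expanding the prediction error \<open>X (\<gamma>hat - \<gamma>) - \<delta>\<close> gives
  \<open>MSEM(yhat_i) - MSEM(yhat_j) = A - \<theta> \<theta>'\<close>. For nonnegative definite \<open>A\<close>, the matrix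
  \<open>A - \<theta> \<theta>'\<close> is nonnegative definite iff \<open>\<theta>\<close> lies in the range of \<open>A\<close> and \<open>\<theta>' A\<^sup>- \<theta> \<le> 1\<close>:
  the bound \<open>(x \<bullet> \<theta>)\<^sup>2 \<le> x \<bullet> A x\<close> makes \<open>\<theta>\<close> orthogonal to the kernel of \<open>A\<close>, hence
  \<open>\<theta> = A z\<close>, and \<open>\<theta>' A\<^sup>- \<theta> = z \<bullet> A z\<close>.\<close>

section \<open>Algebra of outer products\<close>

lemma bilinear_outer: "bilinear (outer :: real^'m \<Rightarrow> real^'n \<Rightarrow> real^'n^'m)"
  unfolding bilinear_def outer_def
  by (auto intro!: linearI simp: vec_eq_iff algebra_simps)

text \<open>In finite dimension bilinearity already forces boundedness. The interpretation below
  then supplies expansion rules, continuity and a norm bound for \<open>outer\<close>.\<close>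

lemma bounded_bilinear_outer:
  "bounded_bilinear (outer :: real^'m \<Rightarrow> real^'n \<Rightarrow> real^'n^'m)"
  using bilinear_outer by (simp add: bilinear_conv_bounded_bilinear)

interpretation outer: bounded_bilinear "outer :: real^'m \<Rightarrow> real^'n \<Rightarrow> real^'n^'m"
  by (rule bounded_bilinear_outer)

lemma outer_mult_vec: "outer x y *v z = (y \<bullet> z) *\<^sub>R x"
  by (simp add: outer_def matrix_vector_mult_def vec_eq_iff inner_vec_def sum_distrib_left
      mult_ac)

lemma matrix_mult_outer_mult_transpose:
  fixes X :: "real^'l^'n" and Y :: "real^'k^'m"
  shows "X ** outer x y ** transpose Y = outer (X *v x) (Y *v y)"
proof -
  have "y \<bullet> (z v* Y) = (Y *v y) \<bullet> z" for z
    by (metis dot_lmul_matrix inner_commute)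
  then show ?thesis
    by (simp add: matrix_eq outer_mult_vec matrix_vector_mult_scaleR
        flip: matrix_vector_mul_assoc)
qed

text \<open>Lets an expectation pass through \<open>X ** P ** transpose X\<close>, and splits the
  conjugate of a difference of two MSEM matrices.\<close>

lemma linear_matrix_conjugation:
  fixes X :: "real^'l^'n" and Y :: "real^'m^'k"
  shows "linear (\<lambda>P. X ** P ** Y)"
  by (auto intro!: linearI
      simp: matrix_eq matrix_vector_mult_add_rdistrib matrix_vector_right_distrib
        scaleR_matrix_vector_assoc[symmetric] matrix_vector_mult_scaleR
      simp flip: matrix_vector_mul_assoc)

lemma inner_symmetric_matrix:
  fixes A :: "real^'n^'n"
  assumes "transpose A = A"
  shows "x \<bullet> (A *v y) = (A *v x) \<bullet> y"
  using assms dot_lmul_matrix[of x A y] by (metis transpose_matrix_vector)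

section \<open>Subtracting a rank-one matrix from a nonnegative definite one\<close>

lemma nonneg_definite_diff_outer_iff:
  fixes A X :: "real^'n^'n"
  assumes A: "nonneg_definite A" and X: "generalized_inverse A X"
  shows "nonneg_definite (A - outer \<theta> \<theta>) \<longleftrightarrow>
    \<theta> \<in> span (columns A) \<and> \<theta> \<bullet> (X *v \<theta>) \<le> 1"
proof -
  have sym: "transpose A = A" and nonneg: "0 \<le> x \<bullet> (A *v x)" for x
    using A by (auto simp: nonneg_definite_def)
  have "transpose (A - outer \<theta> \<theta>) = A - outer \<theta> \<theta>"
    using sym by (simp add: transpose_def outer_def vec_eq_iff mult.commute)
  then have diff_iff: "nonneg_definite (A - outer \<theta> \<theta>) \<longleftrightarrow>
      (\<forall>x. (x \<bullet> \<theta>)\<^sup>2 \<le> x \<bullet> (A *v x))"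
    by (simp add: nonneg_definite_def matrix_vector_mult_diff_rdistrib outer_mult_vec
        inner_diff_right power2_eq_square inner_commute[of \<theta>])
  have span: "span (columns A) = range ((*v) A)"
  proof
    show "span (columns A) \<subseteq> range ((*v) A)"
      by (intro span_minimal linear_subspace_image matrix_vector_mul_linear subspace_UNIV)
        (auto simp: columns_image_basis)
  qed (auto intro: matrix_vector_mult_in_columnspace)
  \<comment> \<open>Symmetry moves the outer copy of \<open>A\<close> across the inner product, so
    \<open>X\<close> occurs only inside \<open>A ** X ** A = A\<close>; its choice is therefore
    immaterial.\<close>
  have form: "\<theta> \<bullet> (X *v \<theta>) = z \<bullet> (A *v z)" if "\<theta> = A *v z" for z
  proof -
    have "\<theta> \<bullet> (X *v \<theta>) = z \<bullet> ((A ** X ** A) *v z)"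
      unfolding that
      by (simp add: inner_symmetric_matrix[OF sym, symmetric] flip: matrix_vector_mul_assoc)
    then show ?thesis
      using X by (simp add: generalized_inverse_def)
  qed
  show ?thesis
    unfolding diff_iff
  proof (intro iffI conjI)
    assume bound: "\<forall>x. (x \<bullet> \<theta>)\<^sup>2 \<le> x \<bullet> (A *v x)"
    \<comment> \<open>The part \<open>w\<close> of \<open>\<theta>\<close> orthogonal to the column
      space is shown to vanish.\<close>
    obtain p w where p: "p \<in> span (columns A)"
      and w: "\<And>c. c \<in> span (columns A) \<Longrightarrow> orthogonal w c" and \<theta>: "\<theta> = p + w"
      using orthogonal_subspace_decomp_exists[of "columns A" \<theta>] by blast
    \<comment> \<open>The vector \<open>A *v (A *v w)\<close> is in the column space; by symmetry
      this inner product is the squared norm of \<open>A *v w\<close>, so \<open>w\<close> lies in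
      the kernel of \<open>A\<close>.\<close>
    have "w \<bullet> (A *v (A *v w)) = 0"
      using w[of "A *v (A *v w)"] by (auto simp: span orthogonal_def)
    then have "A *v w = 0"
      using inner_symmetric_matrix[OF sym, of w "A *v w"] by simp
    then have "w \<bullet> \<theta> = 0"
      using bound[rule_format, of w] by simp
    moreover have "w \<bullet> p = 0"
      using w[OF p] by (simp add: orthogonal_def)
    ultimately have "w = 0"
      by (simp add: \<theta> inner_add_right)
    with p \<theta> show "\<theta> \<in> span (columns A)" by simp
    then obtain z where z: "\<theta> = A *v z" by (auto simp: span)
    \<comment> \<open>The bound at \<open>x = z\<close> says s * s \<le> s for s =
      \<open>z \<bullet> (A *v z)\<close>, which excludes s > 1.\<close>
    have "(z \<bullet> (A *v z))\<^sup>2 \<le> z \<bullet> (A *v z)"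
      using bound z by auto
    then have "z \<bullet> (A *v z) \<le> 1"
      using mult_strict_right_mono[of 1 "z \<bullet> (A *v z)" "z \<bullet> (A *v z)"]
      by (fastforce simp: power2_eq_square not_le[symmetric])
    then show "\<theta> \<bullet> (X *v \<theta>) \<le> 1"
      by (simp add: form[OF z])
  next
    assume "\<theta> \<in> span (columns A) \<and> \<theta> \<bullet> (X *v \<theta>) \<le> 1"
    then obtain z where z: "\<theta> = A *v z" and le1: "z \<bullet> (A *v z) \<le> 1"
      using form by (auto simp: span)
    show "\<forall>x. (x \<bullet> \<theta>)\<^sup>2 \<le> x \<bullet> (A *v x)"
    proof
      fix x
      \<comment> \<open>A Cauchy-Schwarz argument: the form is nonnegative at
        \<open>x - t *\<^sub>R z\<close>, where \<open>t\<close> equals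
        \<open>x \<bullet> \<theta>\<close>. The step \<open>t\<close> replaces the minimizing
        \<open>t / (z \<bullet> (A *v z))\<close>, avoiding a possibly zero denominator; it suffices
        because \<open>2 - z \<bullet> (A *v z)\<close> is at least 1.\<close>
      define t where "t = x \<bullet> (A *v z)"
      have "z \<bullet> (A *v x) = t"
        using inner_symmetric_matrix[OF sym, of z x] by (simp add: t_def inner_commute)
      then have "(x - t *\<^sub>R z) \<bullet> (A *v (x - t *\<^sub>R z)) =
          x \<bullet> (A *v x) - t\<^sup>2 * (2 - z \<bullet> (A *v z))"
        by (simp add: matrix_vector_mult_diff_distrib matrix_vector_mult_scaleR inner_diff_left
            inner_diff_right power2_eq_square algebra_simps flip: t_def)
      moreover have "t\<^sup>2 * 1 \<le> t\<^sup>2 * (2 - z \<bullet> (A *v z))"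
        using le1 by (intro mult_left_mono) auto
      ultimately show "(x \<bullet> \<theta>)\<^sup>2 \<le> x \<bullet> (A *v x)"
        using nonneg[of "x - t *\<^sub>R z"] by (simp add: z t_def)
    qed
  qed
qed

section \<open>Integrability of random vectors with finite second moments\<close>

lemma integrable_dominated:
  fixes f :: "'w \<Rightarrow> 'a::{banach, second_countable_topology}" and h :: "'w \<Rightarrow> real"
  assumes "integrable M h" "f \<in> borel_measurable M" "\<And>\<omega>. norm (f \<omega>) \<le> h \<omega>"
  shows "integrable M f"
  by (rule Bochner_Integration.integrable_bound[OF assms(1,2)])
    (intro AE_I2 order.trans[OF assms(3)], simp)

text \<open>One closure rule for several uses: the mixed estimator is affine in the two errors, and
  with \<open>Q = 0\<close> the rule also covers linear images and shifts of a single
  vector.\<close>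

lemma square_integrable_affine:
  assumes "prob_space M" and f: "square_integrable M f" and g: "square_integrable M g"
  shows "square_integrable M (\<lambda>\<omega>. (P :: real^'m^'k) *v f \<omega> + Q *v g \<omega> + c)"
proof -
  interpret prob_space M by fact
  have [measurable]: "f \<in> borel_measurable M" "g \<in> borel_measurable M"
    and int: "integrable M (\<lambda>\<omega>. (norm (f \<omega>))\<^sup>2)" "integrable M (\<lambda>\<omega>. (norm (g \<omega>))\<^sup>2)"
    using f g by (auto simp: square_integrable_def)
  have meas: "(\<lambda>\<omega>. P *v f \<omega> + Q *v g \<omega> + c) \<in> borel_measurable M"
    by (intro borel_measurable_add borel_measurable_const
        borel_measurable_continuous_on[OF matrix_vector_mult_linear_continuous_on]) auto
  obtain p where p: "\<And>x. norm (P *v x) \<le> norm x * p"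
    using bounded_linear.bounded[OF matrix_vector_mul_bounded_linear[of P]] by blast
  obtain q where q: "\<And>x. norm (Q *v x) \<le> norm x * q"
    using bounded_linear.bounded[OF matrix_vector_mul_bounded_linear[of Q]] by blast
  \<comment> \<open>Each mixed product in the expanded square obeys 2ab \<le> a^2 + b^2.\<close>
  have three: "(a + b + c)\<^sup>2 \<le> 3 * (a\<^sup>2 + b\<^sup>2 + c\<^sup>2)" for a b c :: real
    using sum_squares_bound[of a b] sum_squares_bound[of b c] sum_squares_bound[of a c]
    by (simp add: power2_eq_square algebra_simps)
  have bound: "(norm (P *v f \<omega> + Q *v g \<omega> + c))\<^sup>2 \<le>
      3 * ((norm (f \<omega>))\<^sup>2 * p\<^sup>2 + (norm (g \<omega>))\<^sup>2 * q\<^sup>2 + (norm c)\<^sup>2)" for \<omega>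
  proof -
    have "norm (P *v f \<omega> + Q *v g \<omega> + c) \<le> norm (f \<omega>) * p + norm (g \<omega>) * q + norm c"
      using p[of "f \<omega>"] q[of "g \<omega>"]
      by (intro norm_triangle_le add_mono norm_triangle_le) auto
    then have "(norm (P *v f \<omega> + Q *v g \<omega> + c))\<^sup>2 \<le>
        (norm (f \<omega>) * p + norm (g \<omega>) * q + norm c)\<^sup>2"
      by (intro power_mono) auto
    also have "\<dots> \<le> 3 * ((norm (f \<omega>) * p)\<^sup>2 + (norm (g \<omega>) * q)\<^sup>2 + (norm c)\<^sup>2)"
      by (rule three)
    finally show ?thesis by (simp add: power_mult_distrib)
  qed
  have "integrable M (\<lambda>\<omega>. (norm (P *v f \<omega> + Q *v g \<omega> + c))\<^sup>2)"
  proof (rule integrable_dominated)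
    show "integrable M (\<lambda>\<omega>. 3 * ((norm (f \<omega>))\<^sup>2 * p\<^sup>2 + (norm (g \<omega>))\<^sup>2 * q\<^sup>2 + (norm c)\<^sup>2))"
      using int by simp
    show "(\<lambda>\<omega>. (norm (P *v f \<omega> + Q *v g \<omega> + c))\<^sup>2) \<in> borel_measurable M"
      using meas by measurable
  qed (use bound in simp)
  with meas show ?thesis
    by (simp add: square_integrable_def)
qed

lemma integrable_if_square_integrable:
  fixes f :: "'w \<Rightarrow> real^'n"
  assumes "prob_space M" and "square_integrable M f"
  shows "integrable M f"
proof -
  interpret prob_space M by fact
  \<comment> \<open>Follows from (norm x - 1)^2 \<ge> 0. The dominating function
    \<open>1 + (norm (f \<omega>))\<^sup>2\<close> is integrable because constants are integrable on
    a probability space.\<close>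
  have "norm x \<le> 1 + (norm x)\<^sup>2" for x :: "real^'n"
    using sum_squares_bound[of "norm x" 1] norm_ge_zero[of x] by (simp; linarith)
  with assms(2) show ?thesis
    by - (rule integrable_dominated[where h = "\<lambda>\<omega>. 1 + (norm (f \<omega>))\<^sup>2"],
      auto simp: square_integrable_def)
qed

lemma integrable_outer_if_square_integrable:
  fixes f :: "'w \<Rightarrow> real^'n"
  assumes "square_integrable M f"
  shows "integrable M (\<lambda>\<omega>. outer (f \<omega>) (f \<omega>))"
proof -
  obtain K where K: "\<And>a b. norm (outer (a :: real^'n) (b :: real^'n)) \<le> norm a * norm b * K"
    using outer.bounded by blast
  have "(\<lambda>\<omega>. outer (f \<omega>) (f \<omega>)) \<in> borel_measurable M"
    using assms
    by (intro borel_measurable_continuous_on[where f = "\<lambda>x. outer x x"]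
        outer.continuous_on continuous_on_id) (auto simp: square_integrable_def)
  then show ?thesis
    using assms K
    by - (rule integrable_dominated[where h = "\<lambda>\<omega>. (norm (f \<omega>))\<^sup>2 * K"],
      auto simp: square_integrable_def power2_eq_square)
qed

section \<open>MSEM of a predictor in terms of the MSEM and bias of its estimator\<close>

lemma msem_predictor:
  fixes X :: "real^'l^'n" and \<gamma> :: "real^'l" and \<delta> :: "real^'n"
  assumes prob: "prob_space M" and f: "square_integrable M f"
  defines "b \<equiv> bias M f \<gamma>"
  shows "msem M (\<lambda>\<omega>. X *v f \<omega>) (X *v \<gamma> + \<delta>) =
    X ** msem M f \<gamma> ** transpose X - outer (X *v b) \<delta> - outer \<delta> (X *v b) + outer \<delta> \<delta>"
proof -
  interpret prob_space M by fact
  define e where "e \<omega> = f \<omega> - \<gamma>" for \<omega>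
  have e_sq: "square_integrable M e"
    using square_integrable_affine[OF prob f f, of "mat 1" 0 "- \<gamma>"] by (simp add: e_def[abs_def])
  note int_e = integrable_if_square_integrable[OF prob e_sq]
  note int_ee = integrable_outer_if_square_integrable[OF e_sq]
  have E_e: "(\<integral>\<omega>. e \<omega> \<partial>M) = b"
    using integrable_if_square_integrable[OF prob f]
    by (simp add: e_def[abs_def] b_def bias_def prob_space)
  \<comment> \<open>The quadratic term and the two cross terms of the expanded error are bounded
    linear images of \<open>outer (e \<omega>) (e \<omega>)\<close> and \<open>e \<omega>\<close>,
    so expectation commutes with each; the mean of \<open>e\<close> is the bias.\<close>
  have conj: "bounded_linear (\<lambda>P. X ** P ** transpose X)"
    by (simp add: linear_matrix_conjugation flip: linear_conv_bounded_linear)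
  have left: "bounded_linear (\<lambda>x. outer (X *v x) \<delta>)"
    by (rule bounded_linear_compose[OF outer.bounded_linear_left
          matrix_vector_mul_bounded_linear])
  have right: "bounded_linear (\<lambda>x. outer \<delta> (X *v x))"
    by (rule bounded_linear_compose[OF outer.bounded_linear_right
          matrix_vector_mul_bounded_linear])
  have err: "X *v f \<omega> - (X *v \<gamma> + \<delta>) = X *v e \<omega> - \<delta>" for \<omega>
    by (simp add: e_def matrix_vector_mult_diff_distrib)
  have "msem M (\<lambda>\<omega>. X *v f \<omega>) (X *v \<gamma> + \<delta>) =
      (\<integral>\<omega>. X ** outer (e \<omega>) (e \<omega>) ** transpose X - outer (X *v e \<omega>) \<delta>
         - outer \<delta> (X *v e \<omega>) + outer \<delta> \<delta> \<partial>M)"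
    unfolding msem_def err
    by (simp add: matrix_mult_outer_mult_transpose outer.diff_left outer.diff_right
        algebra_simps)
  also have "\<dots> = (\<integral>\<omega>. X ** outer (e \<omega>) (e \<omega>) ** transpose X \<partial>M)
      - (\<integral>\<omega>. outer (X *v e \<omega>) \<delta> \<partial>M) - (\<integral>\<omega>. outer \<delta> (X *v e \<omega>) \<partial>M) + outer \<delta> \<delta>"
    using integrable_bounded_linear[OF conj int_ee] integrable_bounded_linear[OF left int_e]
      integrable_bounded_linear[OF right int_e]
    by (simp add: prob_space)
  also have "\<dots> = X ** (\<integral>\<omega>. outer (e \<omega>) (e \<omega>) \<partial>M) ** transpose X - outer (X *v b) \<delta>
      - outer \<delta> (X *v b) + outer \<delta> \<delta>"
    using integral_bounded_linear[OF conj int_ee] integral_bounded_linear[OF left int_e]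
      integral_bounded_linear[OF right int_e]
    by (simp add: E_e)
  finally show ?thesis
    by (simp add: msem_def e_def)
qed

theorem theorem2:
  fixes M :: "'w measure"
    and X1 :: "real^'l^'n" and X2 :: "real^'p^'n"
    and \<beta>1 :: "real^'l" and \<beta>2 :: "real^'p"
    and \<sigma> :: real
    and R :: "real^'l^'q" and g :: "real^'q" and W \<Psi> :: "real^'q^'q"
    and \<delta> :: "real^'n"
    and \<epsilon> u y :: "'w \<Rightarrow> real^'n" and v r :: "'w \<Rightarrow> real^'q"
    and B \<Lambda> :: "real^'l^'l" and idx :: "nat \<Rightarrow> 'l"
    and Xs :: "real^'l^'n" and Rs :: "real^'l^'q" and \<gamma> :: "real^'l"
    and mre :: "'w \<Rightarrow> real^'l"
    and Gi Gj :: "real^'l^'l"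
    and \<gamma>hat_i \<gamma>hat_j :: "'w \<Rightarrow> real^'l" and yhat_i yhat_j :: "'w \<Rightarrow> real^'n"
    and y0 :: "real^'n"
    and bi bj :: "real^'l" and \<Delta> :: "real^'l^'l"
    and A :: "real^'n^'n" and \<theta> :: "real^'n"
  assumes prob: "prob_space M"
    and \<epsilon>_sq: "square_integrable M \<epsilon>"
    and v_sq: "square_integrable M v"
    and sigma: "\<sigma>\<^sup>2 > 0"
    \<comment> \<open>true model, misspecified error, prior information\<close>
    and delta: "\<delta> = X2 *v \<beta>2"
    and y: "\<And>\<omega>. y \<omega> = X1 *v \<beta>1 + \<delta> + \<epsilon> \<omega>"
    and u: "\<And>\<omega>. u \<omega> = \<delta> + \<epsilon> \<omega>"
    and r: "\<And>\<omega>. r \<omega> = R *v \<beta>1 + g + v \<omega>"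
    and E_\<epsilon>: "(\<integral>\<omega>. \<epsilon> \<omega> \<partial>M) = 0"
    and E_\<epsilon>\<epsilon>: "(\<integral>\<omega>. outer (\<epsilon> \<omega>) (\<epsilon> \<omega>) \<partial>M) = \<sigma>\<^sup>2 *\<^sub>R mat 1"
    and E_v: "(\<integral>\<omega>. v \<omega> \<partial>M) = 0"
    and E_vv: "(\<integral>\<omega>. outer (v \<omega>) (v \<omega>) \<partial>M) = \<Psi>"
    and Psi: "\<Psi> = \<sigma>\<^sup>2 *\<^sub>R W"
    and W_pd: "pos_definite W"
    and E_vu: "(\<integral>\<omega>. outer (v \<omega>) (u \<omega>) \<partial>M) = 0"
    and rank_R: "rank R = CARD('q)"
    and X1_pd: "pos_definite (transpose X1 ** X1)"
    \<comment> \<open>simultaneous diagonalization; \<open>idx\<close> enumerates the coordinates as \<open>1, \<dots>, l\<close>\<close>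
    and B_inv: "invertible B"
    and B_X1: "transpose B ** transpose X1 ** X1 ** B = mat 1"
    and B_R: "transpose B ** transpose R ** matrix_inv \<Psi> ** R ** B = \<Lambda>"
    and \<Lambda>_diag: "\<And>a b. a \<noteq> b \<Longrightarrow> \<Lambda> $ a $ b = 0"
    and idx: "bij_betw idx {1..CARD('l)} UNIV"
    and \<Lambda>_pos: "\<And>k. 1 \<le> k \<Longrightarrow> k \<le> CARD('q) \<Longrightarrow> \<Lambda> $ idx k $ idx k > 0"
    and \<Lambda>_zero: "\<And>k. CARD('q) < k \<Longrightarrow> k \<le> CARD('l) \<Longrightarrow> \<Lambda> $ idx k $ idx k = 0"
    and Xs: "Xs = X1 ** B"
    and Rs: "Rs = R ** B"
    and gamma: "\<gamma> = matrix_inv B *v \<beta>1"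
    \<comment> \<open>estimators and predictors\<close>
    and mre: "\<And>\<omega>. mre \<omega> = mixed_estimator (\<sigma>\<^sup>2) \<Lambda> Xs Rs W (y \<omega>) (r \<omega>)"
    and Gi_nnd: "nonneg_definite Gi"
    and Gj_nnd: "nonneg_definite Gj"
    and \<gamma>hat_i: "\<And>\<omega>. \<gamma>hat_i \<omega> = Gi *v mre \<omega>"
    and \<gamma>hat_j: "\<And>\<omega>. \<gamma>hat_j \<omega> = Gj *v mre \<omega>"
    and yhat_i: "\<And>\<omega>. yhat_i \<omega> = Xs *v \<gamma>hat_i \<omega>"
    and yhat_j: "\<And>\<omega>. yhat_j \<omega> = Xs *v \<gamma>hat_j \<omega>"
    and y0: "y0 = Xs *v \<gamma> + \<delta>"
    and bi: "bi = bias M \<gamma>hat_i \<gamma>"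
    and bj: "bj = bias M \<gamma>hat_j \<gamma>"
    and Delta: "\<Delta> = msem M \<gamma>hat_i \<gamma> - msem M \<gamma>hat_j \<gamma>"
    and A: "A = Xs ** \<Delta> ** transpose Xs
                + Xs ** outer (bi - bj) (bi - bj) ** transpose Xs + outer \<delta> \<delta>"
    and theta: "\<theta> = \<delta> + Xs *v (bi - bj)"
    and A_nnd: "nonneg_definite A"
  shows "\<forall>Am. generalized_inverse A Am \<longrightarrow>
           (nonneg_definite (msem M yhat_i y0 - msem M yhat_j y0) \<longleftrightarrow>
              \<theta> \<in> span (columns A) \<and> \<theta> \<bullet> (Am *v \<theta>) \<le> 1)"
proof -
  define H where "H = matrix_inv (mat 1 + \<sigma>\<^sup>2 *\<^sub>R \<Lambda>)"
  \<comment> \<open>Collects the non-random part of the mixed estimator, leaving the images of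
    \<open>\<epsilon>\<close> and \<open>v\<close>.\<close>
  define c where "c = H *v (transpose Xs *v (X1 *v \<beta>1 + \<delta>)
      + transpose Rs *v (matrix_inv W *v (R *v \<beta>1 + g)))"
  have "mre = (\<lambda>\<omega>. (H ** transpose Xs) *v \<epsilon> \<omega> + (H ** transpose Rs ** matrix_inv W) *v v \<omega> + c)"
    unfolding fun_eq_iff mre mixed_estimator_def H_def[symmetric] y r c_def
    by (simp add: matrix_vector_right_distrib algebra_simps flip: matrix_vector_mul_assoc)
  then have mre_sq: "square_integrable M mre"
    using square_integrable_affine[OF prob \<epsilon>_sq v_sq] by simp
  have sq: "square_integrable M (\<lambda>\<omega>. G *v mre \<omega>)" for G :: "real^'l^'l"
    using square_integrable_affine[OF prob mre_sq mre_sq, of G 0 0] by simp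
  have hat: "\<gamma>hat_i = (\<lambda>\<omega>. Gi *v mre \<omega>)" "\<gamma>hat_j = (\<lambda>\<omega>. Gj *v mre \<omega>)"
    and yhat: "yhat_i = (\<lambda>\<omega>. Xs *v \<gamma>hat_i \<omega>)" "yhat_j = (\<lambda>\<omega>. Xs *v \<gamma>hat_j \<omega>)"
    using \<gamma>hat_i \<gamma>hat_j yhat_i yhat_j by auto
  have hat_sq: "square_integrable M \<gamma>hat_i" "square_integrable M \<gamma>hat_j"
    unfolding hat by (rule sq)+
  \<comment> \<open>The terms \<open>outer \<delta> \<delta>\<close> cancel in the difference. With
    d = \<open>Xs *v (bi - bj)\<close>, the surviving cross terms are -d\<delta>' - \<delta>d';
    adding and subtracting dd' + \<delta>\<delta>' completes them to
    \<open>A - outer \<theta> \<theta>\<close>.\<close>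
  have "msem M yhat_i y0 - msem M yhat_j y0 = A - outer \<theta> \<theta>"
    unfolding A theta yhat y0 msem_predictor[OF prob hat_sq(1)] msem_predictor[OF prob hat_sq(2)]
      Delta matrix_mult_outer_mult_transpose linear_diff[OF linear_matrix_conjugation]
    by (simp add: outer.add_left outer.add_right outer.diff_left outer.diff_right
        matrix_vector_mult_diff_distrib flip: bi bj)
  with A_nnd show ?thesis
    by (simp add: nonneg_definite_diff_outer_iff)
qed

end
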